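(* Let $G=(\boldsymbol{N},\boldsymbol{L})$ be a finite connected undirected graph, let $\boldsymbol{\Omega}\subseteq\{0,1\}^{\boldsymbol{L}}$ be the set of incidence vectors of spanning trees of $G$, and let $\boldsymbol{\Phi}\subseteq\{0,1\}^{\boldsymbol{L}}$ be the set of incidence vectors of spanning forests of $G$. Consider an explicit mixed-integer linear formulation of the constraint $\boldsymbol{\beta}\in\boldsymbol{\Omega}$, in the variables $\boldsymbol{\beta}=(\beta_{ij})_{(i,j)\in\boldsymbol{L}}$ and possibly finitely many auxiliary variables $\boldsymbol{z}$, and let $Q$ be the feasible set, in $(\boldsymbol{\beta},\boldsymbol{z})$-space, of its LP relaxation. Suppose that the LP relaxation of this formulation defines the spanning tree polytope in the $\boldsymbol{\beta}$-space, i.e. $$\{\boldsymbol{\beta} : \exists\, \boldsymbol{z},\ (\boldsymbol{\beta},\boldsymbol{z})\in Q\}=\mathrm{conv}(\boldsymbol{\Omega}).$$ Then the LP relaxation of the system consisting of this formulation of $\boldsymbol{\beta}\in\boldsymbol{\Omega}$ together with the constraints $\alpha_{ij}\le\beta_{ij}$ for all $(i,j)\in\boldsymbol{L}$, with $\boldsymbol{\alpha}\in\{0,1\}^{\boldsymbol{L}}$, defines the spanning forest polytope in the $\boldsymbol{\alpha}$-space, i.e. $$\{\boldsymbol{\alpha} : \exists\, (\boldsymbol{\beta},\boldsymbol{z})\in Q \text{ such that } 0\le\alpha_{ij}\le 1 \text{ and } \alpha_{ij}\le\beta_{ij}\ \text{ for all } (i,j)\in\boldsymbol{L}\}=\ma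thrm{conv}(\boldsymbol{\Phi}).$$
   Context: The graph $G$ models a distribution system with node set $\boldsymbol{N}$ and branch set $\boldsymbol{L}$; $\alpha_{ij}\in\{0,1\}$ is the connection status of branch $(i,j)$ ($1$ if closed, $0$ if open) and $\beta_{ij}\in\{0,1\}$ is an auxiliary ("fictitious") connection status. A spanning tree of $G$ is a subgraph connecting all vertices of $G$ and containing no cycles. A spanning forest of $G$ is a subgraph with no cycles. The incidence vector of a spanning tree or spanning forest is the $0$-$1$ vector indexed by $\boldsymbol{L}$ that equals $1$ exactly on its edges. The spanning tree polytope is $\mathrm{conv}(\boldsymbol{\Omega})$ and the spanning forest polytope is $\mathrm{conv}(\boldsymbol{\Phi})$, where $\mathrm{conv}$ denotes convex hull. An explicit mixed-integer linear formulation of $\boldsymbol{\beta}\in\boldsymbol{\Omega}$ is a finite system of linear equations and inequalities in $(\boldsymbol{\beta},\boldsymbol{z})$, together with integrality/binary requirements on some of the variables, such that $\boldsymbol{\beta}\in\boldsymbol{\Omega}$ if and only if there is $\boldsymbol{z}$ with $(\boldsymbol{\beta},\boldsymbol{z})$ feasible. The LP relaxation of a mixed-integer linear formulation is obtained by relaxing its integer/binary constraints (a binary variable is relaxed to take values in $[0,1]$). *)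

theory Defs
  imports "HOL-Analysis.Analysis" "HOL-Library.Function_Algebras"
begin

section \<open>Real coordinate spaces\<close>

text \<open>Vectors indexed by a finite set \<open>L\<close> are represented as functions that vanish outside \<open>L\<close>.
  The pointwise vector space structure makes the library's \<^const>\<open>convex\<close> and \<open>convex hull\<close>
  available for them.\<close>

instantiation "fun" :: (type, real_vector) real_vector
begin

definition "c *\<^sub>R f = (\<lambda>x. c *\<^sub>R f x)"

instance
  by standard (simp_all add: scaleR_fun_def fun_eq_iff scaleR_add_right scaleR_add_left)

end

lemma scaleR_fun_apply [simp]: "(c *\<^sub>R f) x = c *\<^sub>R f x"
  by (simp add: scaleR_fun_def)

definition coord_space :: "'x set \<Rightarrow> ('x \<Rightarrow> real) set" where
  "coord_space X = {x. \<forall>i. i \<notin> X \<longrightarrow> x i = 0}"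


section \<open>Undirected graphs, spanning trees and spanning forests\<close>

definition finite_ugraph :: "'v set \<Rightarrow> 'v set set \<Rightarrow> bool" where
  "finite_ugraph N L \<longleftrightarrow> finite N \<and> (\<forall>e\<in>L. e \<subseteq> N \<and> card e = 2)"

definition connects :: "'v set set \<Rightarrow> 'v set \<Rightarrow> bool" where
  "connects T N \<longleftrightarrow> (\<forall>u\<in>N. \<forall>v\<in>N. (u, v) \<in> {(x, y). {x, y} \<in> T}\<^sup>*)"

definition connected_ugraph :: "'v set \<Rightarrow> 'v set set \<Rightarrow> bool" where
  "connected_ugraph N L \<longleftrightarrow> N \<noteq> {} \<and> connects L N"

definition ucycle :: "'v set set \<Rightarrow> 'v list \<Rightarrow> bool" where
  "ucycle T vs \<longleftrightarrow> 3 \<le> length vs \<and> distinct vs \<and>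
     (\<forall>i < length vs. {vs ! i, vs ! (Suc i mod length vs)} \<in> T)"

definition cycle_free :: "'v set set \<Rightarrow> bool" where
  "cycle_free T \<longleftrightarrow> (\<nexists>vs. ucycle T vs)"

text \<open>Spanning trees and forests are given by their edge sets, which is all that their incidence
  vectors depend on. Forests need not be maximal; in particular the empty edge set is one.\<close>

definition spanning_trees :: "'v set \<Rightarrow> 'v set set \<Rightarrow> 'v set set set" where
  "spanning_trees N L = {T. T \<subseteq> L \<and> connects T N \<and> cycle_free T}"

definition spanning_forests :: "'v set set \<Rightarrow> 'v set set set" where
  "spanning_forests L = {T. T \<subseteq> L \<and> cycle_free T}"

definition incidence_vector :: "'v set set \<Rightarrow> 'v set \<Rightarrow> real" where
  "incidence_vector T = indicator T"

definition tree_vectors :: "'v set \<Rightarrow> 'v set set \<Rightarrow> ('v set \<Rightarrow> real) set" where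
  "tree_vectors N L = incidence_vector ` spanning_trees N L"

definition forest_vectors :: "'v set set \<Rightarrow> ('v set \<Rightarrow> real) set" where
  "forest_vectors L = incidence_vector ` spanning_forests L"

definition spanning_tree_polytope :: "'v set \<Rightarrow> 'v set set \<Rightarrow> ('v set \<Rightarrow> real) set" where
  "spanning_tree_polytope N L = convex hull (tree_vectors N L)"

definition spanning_forest_polytope :: "'v set set \<Rightarrow> ('v set \<Rightarrow> real) set" where
  "spanning_forest_polytope L = convex hull (forest_vectors L)"


section \<open>Mixed-integer linear systems\<close>

text \<open>A pair \<open>(a, b)\<close> in \<open>eqs\<close> (in \<open>ineqs\<close>) stands for the constraint
  \<open>\<Sum>i\<in>vars. a i * x i = b\<close> (respectively \<open>\<le> b\<close>).\<close>

record 'x milp =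
  vars :: "'x set"
  eqs :: "(('x \<Rightarrow> real) \<times> real) set"
  ineqs :: "(('x \<Rightarrow> real) \<times> real) set"
  int_vars :: "'x set"
  bin_vars :: "'x set"

definition wf_milp :: "'x milp \<Rightarrow> bool" where
  "wf_milp P \<longleftrightarrow> finite (vars P) \<and> finite (eqs P) \<and> finite (ineqs P) \<and>
     int_vars P \<subseteq> vars P \<and> bin_vars P \<subseteq> vars P"

definition linear_solutions :: "'x milp \<Rightarrow> ('x \<Rightarrow> real) set" where
  "linear_solutions P = {x \<in> coord_space (vars P).
     (\<forall>(a, b)\<in>eqs P. (\<Sum>i\<in>vars P. a i * x i) = b) \<and>
     (\<forall>(a, b)\<in>ineqs P. (\<Sum>i\<in>vars P. a i * x i) \<le> b)}"

definition milp_feasible :: "'x milp \<Rightarrow> ('x \<Rightarrow> real) set" where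
  "milp_feasible P = {x \<in> linear_solutions P.
     (\<forall>i\<in>int_vars P. x i \<in> \<int>) \<and> (\<forall>i\<in>bin_vars P. x i \<in> {0, 1})}"

definition lp_relaxation :: "'x milp \<Rightarrow> ('x \<Rightarrow> real) set" where
  "lp_relaxation P = {x \<in> linear_solutions P. \<forall>i\<in>bin_vars P. 0 \<le> x i \<and> x i \<le> 1}"

text \<open>In a formulation of \<open>\<beta> \<in> S\<close> the variables are split by a sum type: \<open>Inl e\<close> for \<open>e \<in> L\<close> is the
  entry \<open>\<beta> e\<close>, and \<open>Inr k\<close> for \<open>k \<in> Z\<close> is the auxiliary variable \<open>z k\<close>. The point \<open>(\<beta>, z)\<close>
  is \<open>case_sum \<beta> z\<close>. The set \<open>Z\<close> may be empty.\<close>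

definition milp_formulation_of :: "'e set \<Rightarrow> ('e \<Rightarrow> real) set \<Rightarrow> ('e + 'k) milp \<Rightarrow> bool" where
  "milp_formulation_of L S F \<longleftrightarrow> wf_milp F \<and> (\<exists>Z. vars F = L <+> Z) \<and>
     (\<forall>\<beta>. \<beta> \<in> S \<longleftrightarrow> (\<exists>z. case_sum \<beta> z \<in> milp_feasible F))"

text \<open>The system \<open>F\<close> in \<open>(\<beta>, z)\<close> together with \<open>\<alpha> e \<le> \<beta> e\<close> (written as \<open>\<alpha> e - \<beta> e \<le> 0\<close>) for
  \<open>e \<in> L\<close> and binary \<open>\<alpha>\<close>. Its points \<open>(\<alpha>, \<beta>, z)\<close> are \<open>case_sum \<alpha> (case_sum \<beta> z)\<close>.\<close>

definition lift_constraint ::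
    "('y \<Rightarrow> real) \<times> real \<Rightarrow> ('e + 'y \<Rightarrow> real) \<times> real" where
  "lift_constraint = (\<lambda>(a, b). (case_sum (\<lambda>_. 0) a, b))"

definition le_constraint :: "'e \<Rightarrow> ('e + 'e + 'k \<Rightarrow> real) \<times> real" where
  "le_constraint e = (\<lambda>i. indicator {Inl e} i - indicator {Inr (Inl e)} i, 0)"

definition dominated_system :: "'e set \<Rightarrow> ('e + 'k) milp \<Rightarrow> ('e + 'e + 'k) milp" where
  "dominated_system L F = \<lparr>
     vars = L <+> vars F,
     eqs = lift_constraint ` eqs F,
     ineqs = lift_constraint ` ineqs F \<union> le_constraint ` L,
     int_vars = Inr ` int_vars F,
     bin_vars = L <+> bin_vars F\<rparr>"

end

theory Submission
  imports Defs
begin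

text \<open>Only two properties of forests matter. They are closed under deleting edges, and in a
  connected graph each of them is contained in a spanning tree.

  Unfolding the linear system shows that both sets in the theorem consist of the vectors
  \<open>\<alpha>\<close> supported on \<open>L\<close> with \<open>0 \<le> \<alpha> \<le> \<beta>\<close> for some \<open>\<beta>\<close> in the spanning tree polytope
  (\<open>dominated_system_relaxation_iff\<close>). This set is convex and contains the incidence vector of every forest, with an
  enclosing spanning tree as the witness \<open>\<beta>\<close> (\<open>cycle_free_extends_to_spanning_tree\<close>), so it
  contains the forest polytope.

  Conversely, such a \<open>\<beta>\<close> lies in the forest polytope because trees are forests. Deleting an edge
  maps forests to forests, so setting a coordinate to \<open>0\<close>, being linear, maps the forest polytope
  into itself; by convexity the coordinate may then be lowered to any value in between. Lowering
  the coordinates of \<open>\<beta>\<close> one at a time leads to \<open>\<alpha>\<close> (\<open>convex_hull_downward_closed\<close>).\<close>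

section \<open>Lowering coordinates in a convex hull\<close>

lemma convex_hull_zero_coordinate:
  fixes S :: "('a \<Rightarrow> real) set"
  assumes "\<And>x. x \<in> S \<Longrightarrow> x(e := 0) \<in> S" and "y \<in> convex hull S"
  shows "y(e := 0) \<in> convex hull S"
proof -
  let ?f = "\<lambda>x::'a \<Rightarrow> real. x(e := 0)"
  have "linear ?f"
    by (rule linearI) (auto simp: fun_eq_iff)
  then have "?f ` (convex hull S) = convex hull (?f ` S)"
    by (rule convex_hull_linear_image)
  also have "\<dots> \<subseteq> convex hull S"
    using assms(1) by (intro hull_mono) auto
  finally show ?thesis
    using assms(2) by blast
qed

text \<open>The lowered point lies on the segment between \<open>y\<close> and its projection to \<open>y e = 0\<close>.\<close>

lemma convex_hull_lower_coordinate:
  fixes S :: "('a \<Rightarrow> real) set"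
  assumes "\<And>x. x \<in> S \<Longrightarrow> x(e := 0) \<in> S" and y: "y \<in> convex hull S"
    and c: "0 \<le> c" "c \<le> y e"
  shows "y(e := c) \<in> convex hull S"
proof (cases "y e = 0")
  case True
  with c have "y(e := c) = y" by (auto simp: fun_eq_iff)
  with y show ?thesis by simp
next
  case False
  define t where "t = c / y e"
  have t: "0 \<le> t" "t \<le> 1" "t * y e = c"
    using c False by (auto simp: t_def divide_simps)
  have "t *\<^sub>R y + (1 - t) *\<^sub>R y(e := 0) \<in> convex hull S"
    using t y convex_hull_zero_coordinate[OF assms(1) y]
    by (intro convexD[OF convex_convex_hull]) auto
  moreover have "t *\<^sub>R y + (1 - t) *\<^sub>R y(e := 0) = y(e := c)"
    using t by (auto simp: fun_eq_iff algebra_simps)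
  ultimately show ?thesis by simp
qed

lemma convex_hull_downward_closed:
  fixes S :: "('a \<Rightarrow> real) set"
  assumes zero: "\<And>x e. x \<in> S \<Longrightarrow> x(e := 0) \<in> S"
    and "finite L" and y: "y \<in> convex hull S"
    and below: "\<And>e. e \<in> L \<Longrightarrow> 0 \<le> x e \<and> x e \<le> y e"
    and outside: "\<And>e. e \<notin> L \<Longrightarrow> x e = y e"
  shows "x \<in> convex hull S"
proof -
  have "(\<lambda>e. if e \<in> M then x e else y e) \<in> convex hull S" if "M \<subseteq> L" for M
    using finite_subset[OF that \<open>finite L\<close>] that
  proof (induction M rule: finite_induct)
    case empty
    then show ?case using y by simp
  next
    case (insert e M)
    let ?w = "\<lambda>e. if e \<in> M then x e else y e"
    have "?w(e := x e) \<in> convex hull S"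
      using insert below by (intro convex_hull_lower_coordinate zero) auto
    moreover have "?w(e := x e) = (\<lambda>e'. if e' \<in> insert e M then x e' else y e')"
      by (auto simp: fun_eq_iff)
    ultimately show ?case by simp
  qed
  from this[of L] moreover have "(\<lambda>e. if e \<in> L then x e else y e) = x"
    using outside by auto
  ultimately show ?thesis by simp
qed

section \<open>Extending forests to spanning trees\<close>

lemma cycle_free_mono: "cycle_free T \<Longrightarrow> S \<subseteq> T \<Longrightarrow> cycle_free S"
  unfolding cycle_free_def ucycle_def by blast

text \<open>Going around a cycle the other way joins the ends of any of its edges. Distinctness of the
  vertices and length at least three ensure that this detour does not reuse the edge.\<close>

lemma ucycle_detour:
  assumes cyc: "ucycle T vs" and i: "i < length vs"
  defines "e \<equiv> {vs ! i, vs ! (Suc i mod length vs)}"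
  shows "(vs ! (Suc i mod length vs), vs ! i) \<in> {(x, y). {x, y} \<in> T - {e}}\<^sup>*"
proof -
  let ?n = "length vs"
  let ?R = "{(x, y). {x, y} \<in> T - {e}}"
  have n: "3 \<le> ?n" and "distinct vs"
    and edge: "\<And>j. j < ?n \<Longrightarrow> {vs ! j, vs ! (Suc j mod ?n)} \<in> T"
    using cyc by (auto simp: ucycle_def)
  have other: "{vs ! j, vs ! (Suc j mod ?n)} \<noteq> e" if j: "j < ?n" "j \<noteq> i" for j
  proof
    assume "{vs ! j, vs ! (Suc j mod ?n)} = e"
    moreover have "vs ! j \<noteq> vs ! i"
      using j i \<open>distinct vs\<close> by (simp add: nth_eq_iff_index_eq)
    ultimately have "vs ! j = vs ! (Suc i mod ?n)" "vs ! (Suc j mod ?n) = vs ! i"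
      by (auto simp: e_def doubleton_eq_iff)
    moreover have "Suc i mod ?n < ?n" "Suc j mod ?n < ?n"
      using i by (auto intro: mod_less_divisor)
    ultimately have "j = Suc i mod ?n" "Suc j mod ?n = i"
      using j i \<open>distinct vs\<close> by (simp_all add: nth_eq_iff_index_eq)
    with i j n show False
      by (auto simp: mod_Suc split: if_splits)
  qed
  \<comment> \<open>Walking on from the far end of \<open>e\<close>, the first \<open>length vs - 1\<close> steps avoid \<open>e\<close> and end at
    position \<open>i\<close>.\<close>
  have "(vs ! (Suc i mod ?n), vs ! ((Suc i + k) mod ?n)) \<in> ?R\<^sup>*" if "k < ?n" for k
    using that
  proof (induction k)
    case 0
    then show ?case by simp
  next
    case (Suc k)
    let ?j = "(Suc i + k) mod ?n"
    have "?j < ?n" using i by (auto intro: mod_less_divisor)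
    moreover have "?j \<noteq> i"
    proof (cases "Suc i + k < ?n")
      case False
      then have "?j = Suc i + k - ?n"
        using Suc.prems i by (simp add: mod_if)
      then show ?thesis using False Suc.prems by simp
    qed simp
    moreover have "Suc ?j mod ?n = (Suc i + Suc k) mod ?n"
      by (simp add: mod_Suc_eq)
    ultimately have "(vs ! ?j, vs ! ((Suc i + Suc k) mod ?n)) \<in> ?R"
      using edge[of ?j] other[of ?j] by simp
    with Suc show ?case
      by (meson Suc_lessD rtrancl.rtrancl_into_rtrancl)
  qed
  from this[of "?n - 1"] have "(vs ! (Suc i mod ?n), vs ! ((Suc i + (?n - 1)) mod ?n)) \<in> ?R\<^sup>*"
    using n by simp
  moreover have "(Suc i + (?n - 1)) mod ?n = i"
  proof -
    have "Suc i + (?n - 1) = i + ?n" using n by simp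
    then show ?thesis using i by simp
  qed
  ultimately show ?thesis by simp
qed

text \<open>A cycle created by the new edge would pass through it, and its detour would join \<open>x\<close> and \<open>y\<close>
  inside \<open>T\<close>.\<close>

lemma cycle_free_insert:
  assumes "cycle_free T" and "(x, y) \<notin> {(x, y). {x, y} \<in> T}\<^sup>*"
  shows "cycle_free (insert {x, y} T)"
  unfolding cycle_free_def
proof
  let ?R = "{(x, y). {x, y} \<in> T}"
  assume "\<exists>vs. ucycle (insert {x, y} T) vs"
  then obtain vs where cyc: "ucycle (insert {x, y} T) vs" ..
  have "\<not> ucycle T vs"
    using assms(1) by (simp add: cycle_free_def)
  with cyc obtain i where i: "i < length vs"
    and e: "{vs ! i, vs ! (Suc i mod length vs)} = {x, y}"
    by (auto simp: ucycle_def)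
  have "(vs ! (Suc i mod length vs), vs ! i) \<in> {(a, b). {a, b} \<in> insert {x, y} T - {{x, y}}}\<^sup>*"
    using ucycle_detour[OF cyc i] unfolding e .
  also have "\<dots> \<subseteq> ?R\<^sup>*"
    by (rule rtrancl_mono) auto
  finally have path: "(vs ! (Suc i mod length vs), vs ! i) \<in> ?R\<^sup>*" .
  moreover have "sym (?R\<^sup>*)"
    by (rule sym_rtrancl) (auto simp: sym_def insert_commute)
  ultimately have "(x, y) \<in> ?R\<^sup>*"
    using e by (auto simp: doubleton_eq_iff dest: symD)
  with assms(2) show False by simp
qed

text \<open>The spanning tree is an inclusion-maximal cycle-free set of edges containing \<open>T\<close>: by
  maximality it already joins the ends of every edge in \<open>L\<close>.\<close>

lemma cycle_free_extends_to_spanning_tree: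
  assumes "finite L" and "connects L N" and "T \<subseteq> L" and "cycle_free T"
  obtains T' where "T \<subseteq> T'" and "T' \<in> spanning_trees N L"
proof -
  let ?A = "{S. S \<subseteq> L \<and> cycle_free S}"
  have "finite ?A"
    using \<open>finite L\<close> by simp
  moreover have "T \<in> ?A"
    using assms(3,4) by simp
  ultimately have "\<exists>m\<in>?A. T \<subseteq> m \<and> (\<forall>S\<in>?A. m \<subseteq> S \<longrightarrow> m = S)"
    by (rule finite_has_maximal2)
  then obtain T' where T': "T' \<in> ?A" "T \<subseteq> T'" and max: "\<forall>S\<in>?A. T' \<subseteq> S \<longrightarrow> T' = S"
    by (elim bexE conjE)
  let ?R = "{(x, y). {x, y} \<in> T'}"
  have "(x, y) \<in> ?R\<^sup>*" if "{x, y} \<in> L" for x y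
  proof (rule ccontr)
    assume not: "(x, y) \<notin> ?R\<^sup>*"
    have "insert {x, y} T' \<in> ?A"
      using T' that cycle_free_insert[OF _ not] by simp
    with max have "T' = insert {x, y} T'"
      by (meson subset_insertI)
    then have "{x, y} \<in> T'" by blast
    with not show False by auto
  qed
  then have "{(x, y). {x, y} \<in> L}\<^sup>* \<subseteq> ?R\<^sup>*"
    by (intro rtrancl_subset_rtrancl) auto
  with assms(2) have "connects T' N"
    by (auto simp: connects_def)
  with T' show ?thesis
    by (intro that) (auto simp: spanning_trees_def)
qed

section \<open>Vectors dominated by the spanning tree polytope\<close>

lemma convex_hull_subset_coord_space:
  assumes "S \<subseteq> coord_space L"
  shows "convex hull S \<subseteq> coord_space L"
  using assms by (intro hull_minimal) (auto simp: convex_def coord_space_def)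

lemma forest_vectors_subset_coord_space: "forest_vectors L \<subseteq> coord_space L"
  by (auto simp: forest_vectors_def spanning_forests_def incidence_vector_def coord_space_def
      indicator_def)

lemma tree_vectors_subset_forest_vectors: "tree_vectors N L \<subseteq> forest_vectors L"
  by (auto simp: tree_vectors_def forest_vectors_def spanning_trees_def spanning_forests_def)

lemma forest_vectors_zero_coordinate:
  assumes "x \<in> forest_vectors L"
  shows "x(e := 0) \<in> forest_vectors L"
proof -
  from assms obtain T where T: "T \<subseteq> L" "cycle_free T" "x = incidence_vector T"
    by (auto simp: forest_vectors_def spanning_forests_def)
  have "T - {e} \<in> spanning_forests L"
    using T cycle_free_mono[of T "T - {e}"] by (auto simp: spanning_forests_def)
  moreover have "x(e := 0) = incidence_vector (T - {e})"
    using T by (auto simp: incidence_vector_def indicator_def)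
  ultimately show ?thesis by (auto simp: forest_vectors_def)
qed

lemma spanning_forest_polytope_eq_dominated:
  assumes "finite L" and "connects L N"
  shows "spanning_forest_polytope L =
    {\<alpha> \<in> coord_space L. \<exists>\<beta> \<in> spanning_tree_polytope N L.
       \<forall>e\<in>L. 0 \<le> \<alpha> e \<and> \<alpha> e \<le> 1 \<and> \<alpha> e \<le> \<beta> e}" (is "_ = ?D")
proof
  have "forest_vectors L \<subseteq> ?D"
  proof
    fix x assume x: "x \<in> forest_vectors L"
    then obtain T where T: "T \<subseteq> L" "cycle_free T" "x = incidence_vector T"
      by (auto simp: forest_vectors_def spanning_forests_def)
    obtain T' where "T \<subseteq> T'" "T' \<in> spanning_trees N L"
      using cycle_free_extends_to_spanning_tree[OF assms T(1,2)] .
    then have "incidence_vector T' \<in> spanning_tree_polytope N L"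
      "\<forall>e. x e \<le> incidence_vector T' e"
      using T by (auto simp: spanning_tree_polytope_def tree_vectors_def incidence_vector_def
          indicator_def intro: hull_inc)
    moreover have "\<forall>e. 0 \<le> x e \<and> x e \<le> 1"
      using T by (simp add: incidence_vector_def indicator_def)
    ultimately show "x \<in> ?D"
      using x forest_vectors_subset_coord_space by blast
  qed
  moreover have "convex ?D"
  proof (rule convexI)
    fix x y :: "'a set \<Rightarrow> real" and u v :: real
    assume "x \<in> ?D" "y \<in> ?D" and uv: "0 \<le> u" "0 \<le> v" "u + v = 1"
    then obtain b c where b: "b \<in> spanning_tree_polytope N L"
        "\<forall>e\<in>L. 0 \<le> x e \<and> x e \<le> 1 \<and> x e \<le> b e"
      and c: "c \<in> spanning_tree_polytope N L" "\<forall>e\<in>L. 0 \<le> y e \<and> y e \<le> 1 \<and> y e \<le> c e"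
      and xy: "x \<in> coord_space L" "y \<in> coord_space L"
      by blast
    have "u *\<^sub>R b + v *\<^sub>R c \<in> spanning_tree_polytope N L"
      using b c uv unfolding spanning_tree_polytope_def
      by (intro convexD[OF convex_convex_hull]) auto
    moreover have "u *\<^sub>R x + v *\<^sub>R y \<in> coord_space L"
      using xy by (simp add: coord_space_def)
    moreover have "0 \<le> u * x e + v * y e \<and> u * x e + v * y e \<le> 1
        \<and> u * x e + v * y e \<le> u * b e + v * c e" if "e \<in> L" for e
      using b c uv that by (auto intro!: add_mono mult_left_mono convex_bound_le)
    ultimately show "u *\<^sub>R x + v *\<^sub>R y \<in> ?D"
      by (intro CollectI conjI bexI[of _ "u *\<^sub>R b + v *\<^sub>R c"]) simp_all
  qed
  ultimately show "spanning_forest_polytope L \<subseteq> ?D"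
    unfolding spanning_forest_polytope_def by (rule hull_minimal)
next
  show "?D \<subseteq> spanning_forest_polytope L"
  proof
    fix x assume "x \<in> ?D"
    then obtain b where x: "x \<in> coord_space L" and b: "b \<in> spanning_tree_polytope N L"
      and le: "\<forall>e\<in>L. 0 \<le> x e \<and> x e \<le> 1 \<and> x e \<le> b e"
      by blast
    have b': "b \<in> convex hull forest_vectors L"
      using b hull_mono[OF tree_vectors_subset_forest_vectors]
      unfolding spanning_tree_polytope_def by blast
    then have "b \<in> coord_space L"
      using convex_hull_subset_coord_space[OF forest_vectors_subset_coord_space] by blast
    with x le show "x \<in> spanning_forest_polytope L"
      unfolding spanning_forest_polytope_def
      by (intro convex_hull_downward_closed[OF forest_vectors_zero_coordinate \<open>finite L\<close> b'])
        (auto simp: coord_space_def)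
  qed
qed

section \<open>The relaxation of the combined system\<close>

lemma case_sum_in_coord_space_iff:
  "case_sum f g \<in> coord_space (A <+> B) \<longleftrightarrow> f \<in> coord_space A \<and> g \<in> coord_space B"
  by (auto simp: coord_space_def split: sum.splits)

lemma sum_lift_constraint:
  assumes "finite L" and "finite V"
  shows "(\<Sum>i\<in>L <+> V. case_sum (\<lambda>_. 0) a i * case_sum \<alpha> x i) = (\<Sum>i\<in>V. a i * x i :: real)"
  using assms by (simp add: sum.Plus)

lemma sum_le_constraint:
  assumes "finite L" and "finite V" and "e \<in> L" and "Inl e \<in> V"
  shows "(\<Sum>i\<in>L <+> V. fst (le_constraint e) i * case_sum \<alpha> x i) = \<alpha> e - x (Inl e)"
proof -
  have "(\<Sum>i\<in>L. indicator {Inl e} (Inl i :: 'a + 'a + 'b) * \<alpha> i) = \<alpha> e"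
    using assms by (simp add: indicator_def if_distrib[of "\<lambda>c. c * _"] sum.delta cong: if_cong)
  moreover have "(\<Sum>i\<in>V. indicator {Inr (Inl e)} (Inr i :: 'a + 'a + 'b) * x i) = x (Inl e)"
    using assms by (simp add: indicator_def if_distrib[of "\<lambda>c. c * _"] sum.delta cong: if_cong)
  ultimately show ?thesis
    using assms by (simp add: sum.Plus le_constraint_def sum_negf)
qed

lemma dominated_system_relaxation_iff:
  assumes "finite L" and "finite (vars F)" and "Inl ` L \<subseteq> vars F"
  shows "case_sum \<alpha> (case_sum \<beta> z) \<in> lp_relaxation (dominated_system L F) \<longleftrightarrow>
    \<alpha> \<in> coord_space L \<and> case_sum \<beta> z \<in> lp_relaxation F \<and>
    (\<forall>e\<in>L. 0 \<le> \<alpha> e \<and> \<alpha> e \<le> 1 \<and> \<alpha> e \<le> \<beta> e)"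
proof -
  let ?x = "case_sum \<beta> z"
  let ?y = "case_sum \<alpha> ?x"
  let ?V = "L <+> vars F"
  have eqs: "(\<forall>(a, b)\<in>lift_constraint ` eqs F. (\<Sum>i\<in>?V. a i * ?y i) = b) \<longleftrightarrow>
      (\<forall>(a, b)\<in>eqs F. (\<Sum>i\<in>vars F. a i * ?x i) = b)"
    using assms by (auto simp: lift_constraint_def sum_lift_constraint split_beta)
  have ineqs: "(\<forall>(a, b)\<in>lift_constraint ` ineqs F. (\<Sum>i\<in>?V. a i * ?y i) \<le> b) \<longleftrightarrow>
      (\<forall>(a, b)\<in>ineqs F. (\<Sum>i\<in>vars F. a i * ?x i) \<le> b)"
    using assms by (auto simp: lift_constraint_def sum_lift_constraint split_beta)
  have dom: "(\<Sum>i\<in>?V. fst (le_constraint e) i * ?y i) \<le> snd (le_constraint e) \<longleftrightarrow> \<alpha> e \<le> \<beta> e"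
    if "e \<in> L" for e
  proof -
    have "Inl e \<in> vars F" using assms(3) that by auto
    then show ?thesis
      using sum_le_constraint[OF assms(1,2) that, of \<alpha> ?x] by (simp add: le_constraint_def)
  qed
  have doms: "(\<forall>(a, b)\<in>le_constraint ` L. (\<Sum>i\<in>?V. a i * ?y i) \<le> b) \<longleftrightarrow>
      (\<forall>e\<in>L. \<alpha> e \<le> \<beta> e)"
    unfolding split_beta ball_simps by (rule ball_cong[OF refl dom])
  have bins: "(\<forall>i\<in>L <+> bin_vars F. 0 \<le> ?y i \<and> ?y i \<le> 1) \<longleftrightarrow>
      (\<forall>e\<in>L. 0 \<le> \<alpha> e \<and> \<alpha> e \<le> 1) \<and> (\<forall>i\<in>bin_vars F. 0 \<le> ?x i \<and> ?x i \<le> 1)"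
    by (simp add: Plus_def ball_Un)
  show ?thesis
    unfolding lp_relaxation_def linear_solutions_def dominated_system_def
    by (simp only: milp.simps mem_Collect_eq ball_Un case_sum_in_coord_space_iff
        eqs ineqs doms bins) (simp only: ball_conj_distrib conj_ac)
qed

section \<open>The relaxation projects onto the spanning forest polytope\<close>

theorem proposition1:
  fixes N :: "'v set" and L :: "'v set set" and F :: "('v set + 'k) milp"
  assumes "finite_ugraph N L"
    and "connected_ugraph N L"
    and "milp_formulation_of L (tree_vectors N L) F"
    and "{\<beta>. \<exists>z. case_sum \<beta> z \<in> lp_relaxation F} = spanning_tree_polytope N L"
  shows "{\<alpha>. \<exists>\<beta> z. case_sum \<alpha> (case_sum \<beta> z) \<in> lp_relaxation (dominated_system L F)}
           = spanning_forest_polytope L \<and>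
         {\<alpha> \<in> coord_space L. \<exists>\<beta> z. case_sum \<beta> z \<in> lp_relaxation F \<and>
             (\<forall>e\<in>L. 0 \<le> \<alpha> e \<and> \<alpha> e \<le> 1 \<and> \<alpha> e \<le> \<beta> e)}
           = spanning_forest_polytope L"
proof -
  have "L \<subseteq> Pow N" "finite N"
    using assms(1) by (auto simp: finite_ugraph_def)
  then have "finite L"
    by (meson finite_Pow_iff finite_subset)
  moreover have "finite (vars F)" "Inl ` L \<subseteq> vars F"
    using assms(3) by (auto simp: milp_formulation_of_def wf_milp_def)
  ultimately have system: "{\<alpha>. \<exists>\<beta> z. case_sum \<alpha> (case_sum \<beta> z) \<in> lp_relaxation (dominated_system L F)} =
      {\<alpha> \<in> coord_space L. \<exists>\<beta> z. case_sum \<beta> z \<in> lp_relaxation F \<and>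
         (\<forall>e\<in>L. 0 \<le> \<alpha> e \<and> \<alpha> e \<le> 1 \<and> \<alpha> e \<le> \<beta> e)}"
    by (simp add: dominated_system_relaxation_iff)
  have "connects L N"
    using assms(2) by (simp add: connected_ugraph_def)
  from spanning_forest_polytope_eq_dominated[OF \<open>finite L\<close> this]
  have "{\<alpha> \<in> coord_space L. \<exists>\<beta> z. case_sum \<beta> z \<in> lp_relaxation F \<and>
         (\<forall>e\<in>L. 0 \<le> \<alpha> e \<and> \<alpha> e \<le> 1 \<and> \<alpha> e \<le> \<beta> e)} = spanning_forest_polytope L"
    unfolding assms(4)[symmetric] by blast
  with system show ?thesis by simp
qed

end
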